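(* Let $\mathcal S=\{S_1,\dots,S_m\}$ be a self-similar zipper in $\mathbb R^n$ with vertices $\{z_0=0,z_1,\dots,z_m\}$ and signature $\varepsilon=(\varepsilon_1,\dots,\varepsilon_m)$, and let $f:[0,1]\to\mathbb R^n$ be its linear parametrization by a line zipper $\mathcal T=\{T_1,\dots,T_m\}$ with vertices $\{t_0,\dots,t_m\}$ and the same signature $\varepsilon$. Then the graph $\{(t,g(t)): t\in[0,1]\}\subset\mathbb R^{n+1}$ of the function $g(t)=\int_0^t f(\tau)\,d\tau$ is the attractor of a self-affine zipper in $\mathbb R^{n+1}$ with the signature $\varepsilon$.
   Context: Let $X$ be a complete metric space. A system $\mathcal S=\{S_1,\dots,S_m\}$ of contraction mappings of $X$ to itself is called a zipper with vertices $\{z_0,\dots,z_m\}$ and signature $\varepsilon=(\varepsilon_1,\dots,\varepsilon_m)$, $\varepsilon_i\in\{0,1\}$, if for every $i=1,\dots,m$ one has $S_i(z_0)=z_{i-1+\varepsilon_i}$ and $S_i(z_m)=z_{i-\varepsilon_i}$. The zipper is called self-similar if all $S_i$ are similarities, and self-affine if all $S_i$ are affine mappings. The attractor of a system $\mathcal S=\{S_1,\dots,S_m\}$ is the unique nonempty compact set $K\subset X$ with $K=\bigcup_{i=1}^m S_i(K)$. A line zipper is a zipper $\mathcal T=\{T_1,\dots,T_m\}$ in $[0,1]$ with vertices $0=t_0<t_1<\dots<t_m=1$; here each $T_i$ is a similarity mapping $[0,1]$ onto $[t_{i-1},t_i]$. If $\mathcal S$ is a zipper with vertices $\{z_0,\dots,z_m\}$,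 signature $\varepsilon$ and attractor $\gamma$, and $\mathcal T$ is a line zipper with vertices $\{t_0,\dots,t_m\}$ and the same signature $\varepsilon$, then there is a unique continuous map $f:[0,1]\to\gamma$ such that $f(t_i)=z_i$ for all $i$ and $f(T_i(t))=S_i(f(t))$ for all $i=1,\dots,m$ and $t\in[0,1]$. This $f$ is called the linear parametrization of $\mathcal S$ by $\mathcal T$.
   Formalization: The maps of the self-affine zipper in R^{n+1} are contractions for the Euclidean metric in suitable linear coordinates, |Lx−Ly| with L a linear bijection, not always for the standard metric, for which the claim can fail (e.g. g(t)=2t², signature (1,1)). *)

theory Defs
  imports "HOL-Analysis.Analysis"
begin

definition contraction_map :: "'a metric \<Rightarrow> ('a \<Rightarrow> 'a) \<Rightarrow> bool" where
  "contraction_map M S \<longleftrightarrow>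
     S \<in> mspace M \<rightarrow> mspace M \<and>
     (\<exists>k. 0 \<le> k \<and> k < 1 \<and>
        (\<forall>x\<in>mspace M. \<forall>y\<in>mspace M. mdist M (S x) (S y) \<le> k * mdist M x y))"

definition similarity_map :: "'a metric \<Rightarrow> ('a \<Rightarrow> 'a) \<Rightarrow> bool" where
  "similarity_map M S \<longleftrightarrow>
     S \<in> mspace M \<rightarrow> mspace M \<and>
     (\<exists>r>0. \<forall>x\<in>mspace M. \<forall>y\<in>mspace M. mdist M (S x) (S y) = r * mdist M x y)"

definition affine_mapping :: "('a::real_vector \<Rightarrow> 'b::real_vector) \<Rightarrow> bool" where
  "affine_mapping S \<longleftrightarrow> (\<exists>A c. linear A \<and> S = (\<lambda>x. A x + c))"

text \<open>The maps are \<open>S 1, \<dots>, S m\<close>, the vertices \<open>z 0, \<dots>, z m\<close>; values at other indices are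
  irrelevant. The truncated subtractions below are harmless because \<open>1 \<le> i\<close> and \<open>\<epsilon> i \<le> 1\<close>.\<close>

definition zipper ::
  "'a metric \<Rightarrow> nat \<Rightarrow> (nat \<Rightarrow> 'a \<Rightarrow> 'a) \<Rightarrow> (nat \<Rightarrow> 'a) \<Rightarrow> (nat \<Rightarrow> nat) \<Rightarrow> bool" where
  "zipper M m S z \<epsilon> \<longleftrightarrow>
     mcomplete_of M \<and> 1 \<le> m \<and>
     (\<forall>i\<in>{0..m}. z i \<in> mspace M) \<and>
     (\<forall>i\<in>{1..m}. \<epsilon> i \<in> {0, 1} \<and> contraction_map M (S i) \<and>
        S i (z 0) = z (i - 1 + \<epsilon> i) \<and> S i (z m) = z (i - \<epsilon> i))"

definition self_similar_zipper ::
  "'a metric \<Rightarrow> nat \<Rightarrow> (nat \<Rightarrow> 'a \<Rightarrow> 'a) \<Rightarrow> (nat \<Rightarrow> 'a) \<Rightarrow> (nat \<Rightarrow> nat) \<Rightarrow> bool" where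
  "self_similar_zipper M m S z \<epsilon> \<longleftrightarrow>
     zipper M m S z \<epsilon> \<and> (\<forall>i\<in>{1..m}. similarity_map M (S i))"

definition self_affine_zipper ::
  "'a::real_vector metric \<Rightarrow> nat \<Rightarrow> (nat \<Rightarrow> 'a \<Rightarrow> 'a) \<Rightarrow> (nat \<Rightarrow> 'a) \<Rightarrow> (nat \<Rightarrow> nat) \<Rightarrow> bool" where
  "self_affine_zipper M m S z \<epsilon> \<longleftrightarrow>
     zipper M m S z \<epsilon> \<and> (\<forall>i\<in>{1..m}. affine_mapping (S i))"

definition compact_invariant :: "'a metric \<Rightarrow> nat \<Rightarrow> (nat \<Rightarrow> 'a \<Rightarrow> 'a) \<Rightarrow> 'a set \<Rightarrow> bool" where
  "compact_invariant M m S K \<longleftrightarrow>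
     K \<noteq> {} \<and> compactin (mtopology_of M) K \<and> K = (\<Union>i\<in>{1..m}. S i ` K)"

definition is_attractor :: "'a metric \<Rightarrow> nat \<Rightarrow> (nat \<Rightarrow> 'a \<Rightarrow> 'a) \<Rightarrow> 'a set \<Rightarrow> bool" where
  "is_attractor M m S K \<longleftrightarrow>
     compact_invariant M m S K \<and> (\<forall>K'. compact_invariant M m S K' \<longrightarrow> K' = K)"

definition line_zipper ::
  "nat \<Rightarrow> (nat \<Rightarrow> real \<Rightarrow> real) \<Rightarrow> (nat \<Rightarrow> real) \<Rightarrow> (nat \<Rightarrow> nat) \<Rightarrow> bool" where
  "line_zipper m T t \<epsilon> \<longleftrightarrow>
     self_similar_zipper (submetric euclidean_metric {0..1}) m T t \<epsilon> \<and>
     t 0 = 0 \<and> t m = 1 \<and>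
     (\<forall>i\<in>{1..m}. t (i - 1) < t i \<and> T i ` {0..1} = {t (i - 1)..t i})"

definition linear_parametrization ::
  "'a metric \<Rightarrow> nat \<Rightarrow> (nat \<Rightarrow> 'a \<Rightarrow> 'a) \<Rightarrow> (nat \<Rightarrow> 'a) \<Rightarrow> 'a set \<Rightarrow>
   (nat \<Rightarrow> real \<Rightarrow> real) \<Rightarrow> (nat \<Rightarrow> real) \<Rightarrow> (real \<Rightarrow> 'a) \<Rightarrow> bool" where
  "linear_parametrization M m S z \<gamma> T t f \<longleftrightarrow>
     continuous_map (top_of_set {0..1}) (mtopology_of M) f \<and>
     f ` {0..1} \<subseteq> \<gamma> \<and>
     (\<forall>i\<in>{0..m}. f (t i) = z i) \<and>
     (\<forall>i\<in>{1..m}. \<forall>s\<in>{0..1}. f (T i s) = S i (f s))"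

text \<open>The Euclidean metric read in the linear coordinates \<open>L\<close>; for bijective \<open>L\<close> these are exactly
  the metrics induced by inner products, and they all induce the usual topology. The affine maps whose
  attractor is the graph of an integral involve shears of arbitrary size, so they are contractions
  only after a suitable choice of \<open>L\<close>, not in general for the standard Euclidean metric.\<close>

definition euclidean_metric_in ::
  "('a::euclidean_space \<Rightarrow> 'a) \<Rightarrow> 'a metric" where
  "euclidean_metric_in L = metric (UNIV, \<lambda>x y. dist (L x) (L y))"

lemma euclidean_metric_in_simps:
  assumes "inj L"
  shows "mspace (euclidean_metric_in L) = UNIV"
    and "mdist (euclidean_metric_in L) = (\<lambda>x y. dist (L x) (L y))"
proof -
  interpret Metric_space UNIV "\<lambda>x y. dist (L x) (L y)"
    by unfold_locales (use assms in \<open>auto simp: dist_commute dist_triangle inj_eq\<close>)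
  show "mspace (euclidean_metric_in L) = UNIV"
    and "mdist (euclidean_metric_in L) = (\<lambda>x y. dist (L x) (L y))"
    by (simp_all add: euclidean_metric_in_def mspace_metric mdist_metric)
qed

end

theory Submission
  imports Defs
begin

text \<open>Write \<open>S i x = A i x + c i\<close> and \<open>T i s = T i 0 + q i * s\<close>. Integrating the functional equation
  \<open>f (T i s) = S i (f s)\<close> gives \<open>g (T i s) = g (T i 0) + q i *\<^sub>R (A i (g s) + s *\<^sub>R c i)\<close>, so the affine
  map \<open>R i (s, x) = (T i 0 + q i * s, g (T i 0) + q i *\<^sub>R (A i x + s *\<^sub>R c i))\<close> sends the graph of
  \<open>g\<close> onto its part above \<open>{t (i - 1)..t i}\<close>. Since \<open>\<bar>q i\<bar> < 1\<close>, stretching the time axis enough makes all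
  \<open>R i\<close> contractions, and compact invariant sets of contractions are unique.\<close>

section \<open>Metrics in linear coordinates and uniqueness of compact invariant sets\<close>

lemma mtopology_of_euclidean_metric_in:
  fixes L :: "'a::euclidean_space \<Rightarrow> 'a"
  assumes "linear L" "bij L"
  shows "mtopology_of (euclidean_metric_in L) = euclidean"
proof -
  have inj: "inj L" and surj: "surj L"
    using assms(2) by (auto simp: bij_def)
  have "openin (mtopology_of (euclidean_metric_in L)) U \<longleftrightarrow> open U" for U
  proof -
    interpret Metric_space UNIV "\<lambda>x y. dist (L x) (L y)"
      by unfold_locales (use inj in \<open>auto simp: dist_commute dist_triangle inj_eq\<close>)
    have "openin (mtopology_of (euclidean_metric_in L)) U \<longleftrightarrow>
        (\<forall>x\<in>U. \<exists>r>0. \<forall>y. dist (L x) (L y) < r \<longrightarrow> y \<in> U)"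
      by (auto simp: mtopology_of_def euclidean_metric_in_simps[OF inj] openin_mtopology subset_iff)
    also have "\<dots> \<longleftrightarrow> (\<forall>x\<in>U. \<exists>r>0. ball (L x) r \<subseteq> L ` U)"
    proof -
      have "(\<forall>y. dist (L x) (L y) < r \<longrightarrow> y \<in> U) \<longleftrightarrow> ball (L x) r \<subseteq> L ` U" for x r
      proof -
        have "ball (L x) r \<subseteq> L ` U \<longleftrightarrow> (\<forall>y. L y \<in> ball (L x) r \<longrightarrow> L y \<in> L ` U)"
          using surj by (metis subset_iff surj_def)
        then show ?thesis
          by (simp add: inj_image_mem_iff[OF inj])
      qed
      then show ?thesis by simp
    qed
    also have "\<dots> \<longleftrightarrow> open (L ` U)"
      by (auto simp: open_contains_ball)
    also have "\<dots> \<longleftrightarrow> open U"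
      using open_bijective_linear_image_eq[OF assms] .
    finally show ?thesis .
  qed
  then show ?thesis
    by (simp add: topology_eq)
qed

lemma mcomplete_of_euclidean_metric_in:
  fixes L :: "'a::euclidean_space \<Rightarrow> 'a"
  assumes "inj L" "surj L"
  shows "mcomplete_of (euclidean_metric_in L)"
proof -
  interpret Metric_space UNIV "\<lambda>x y. dist (L x) (L y)"
    by unfold_locales (use assms in \<open>auto simp: dist_commute dist_triangle inj_eq\<close>)
  have "mcomplete"
    unfolding mcomplete_def
  proof (intro allI impI)
    fix \<sigma> assume "MCauchy \<sigma>"
    then have "Cauchy (L \<circ> \<sigma>)"
      by (simp add: MCauchy_def Cauchy_def)
    then obtain y where y: "(L \<circ> \<sigma>) \<longlonglongrightarrow> y"
      using Cauchy_convergent convergent_def by blast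
    obtain x where "y = L x"
      using assms(2) by blast
    with y have "limitin mtopology \<sigma> x sequentially"
      by (auto simp: limitin_metric tendsto_iff)
    then show "\<exists>x. limitin mtopology \<sigma> x sequentially" ..
  qed
  then show ?thesis
    by (simp add: mcomplete_of_def euclidean_metric_in_simps[OF assms(1)])
qed

text \<open>Let \<open>x\<close> in \<open>P\<close> be at maximal distance from \<open>Q\<close>.
  It equals \<open>R i x'\<close> for some \<open>x'\<close> in \<open>P\<close>, and
  \<open>R i\<close> maps a point of \<open>Q\<close> nearest to \<open>x'\<close> into
  \<open>Q\<close>, so the maximal distance is at most \<open>k\<close> < 1 times itself and hence
  zero. Exchanging the two sets gives equality. Passing to images under \<open>L\<close> makes all
  these distances Euclidean.\<close>

lemma compact_invariant_unique:
  fixes L :: "'a::euclidean_space \<Rightarrow> 'a"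
  assumes L: "linear L" "bij L"
    and contr: "\<And>i. i \<in> {1..m} \<Longrightarrow> contraction_map (euclidean_metric_in L) (R i)"
    and K: "compact_invariant (euclidean_metric_in L) m R K"
    and K': "compact_invariant (euclidean_metric_in L) m R K'"
  shows "K' = K"
proof -
  have inj: "inj L"
    using L(2) by (simp add: bij_def)
  have cont: "continuous_on A L" for A
    using L(1) by (simp add: linear_continuous_on linear_linear)
  have sub: "P \<subseteq> Q"
    if P: "compact_invariant (euclidean_metric_in L) m R P"
      and Q: "compact_invariant (euclidean_metric_in L) m R Q" for P Q
  proof -
    have cP: "compact P" "P \<noteq> {}" and P_eq: "P = (\<Union>i\<in>{1..m}. R i ` P)"
      and cQ: "compact Q" "Q \<noteq> {}" and Q_eq: "Q = (\<Union>i\<in>{1..m}. R i ` Q)"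
      using P Q by (auto simp: compact_invariant_def mtopology_of_euclidean_metric_in[OF L])
    have closedLQ: "closed (L ` Q)" and neLQ: "L ` Q \<noteq> {}"
      using cQ cont by (auto intro!: compact_imp_closed compact_continuous_image)
    have "continuous_on P (\<lambda>x. infdist (L x) (L ` Q))"
      using cont by (intro continuous_intros)
    then obtain x where x: "x \<in> P"
      and max: "\<And>y. y \<in> P \<Longrightarrow> infdist (L y) (L ` Q) \<le> infdist (L x) (L ` Q)"
      using continuous_attains_sup[OF cP] by blast
    obtain i x' where i: "i \<in> {1..m}" and x': "x' \<in> P" "x = R i x'"
      using x P_eq by blast
    obtain k where k: "0 \<le> k" "k < 1"
      "\<And>u v. dist (L (R i u)) (L (R i v)) \<le> k * dist (L u) (L v)"
      using contr[OF i] by (auto simp: contraction_map_def euclidean_metric_in_simps[OF inj])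
    obtain y where y: "y \<in> Q" "infdist (L x') (L ` Q) = dist (L x') (L y)"
      using infdist_attains_inf[OF closedLQ neLQ, of "L x'"] by blast
    have "R i y \<in> Q"
      using y(1) i Q_eq by blast
    then have "infdist (L x) (L ` Q) \<le> dist (L (R i x')) (L (R i y))"
      using x'(2) by (auto intro: infdist_le)
    also have "\<dots> \<le> k * infdist (L x') (L ` Q)"
      using k(3) y(2) by simp
    also have "\<dots> \<le> k * infdist (L x) (L ` Q)"
      using max[OF x'(1)] k(1) by (rule mult_left_mono)
    finally have "(1 - k) * infdist (L x) (L ` Q) \<le> 0"
      by (simp add: algebra_simps)
    then have "infdist (L x) (L ` Q) \<le> 0"
      using k(2) by (simp add: mult_le_0_iff)
    then have "infdist (L y) (L ` Q) = 0" if "y \<in> P" for y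
      using max[OF that] infdist_nonneg[of "L y" "L ` Q"] by linarith
    then have "L y \<in> L ` Q" if "y \<in> P" for y
      using in_closed_iff_infdist_zero[OF closedLQ neLQ] that by blast
    then show ?thesis
      using inj by (auto simp: inj_image_mem_iff)
  qed
  show ?thesis
    using sub[OF K K'] sub[OF K' K] by blast
qed

section \<open>Affine form of the similarities and the integrated functional equation\<close>

lemma similarity_map_euclidean_affine:
  fixes S :: "'a::euclidean_space \<Rightarrow> 'a"
  assumes "similarity_map euclidean_metric S" "contraction_map euclidean_metric S"
  obtains A c where "linear A" "\<And>x. S x = A x + c" "\<And>x. norm (A x) \<le> norm x"
proof -
  obtain r where r: "\<And>x y. dist (S x) (S y) = r * dist x y"
    using assms(1) by (auto simp: similarity_map_def)
  obtain k where k: "k < 1" "\<And>x y. dist (S x) (S y) \<le> k * dist x y"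
    using assms(2) by (auto simp: contraction_map_def)
  \<comment> \<open>After translation to fix the origin, a similarity still scales all distances by
    \<open>r\<close>, and such a map is linear. The contraction property then bounds
    \<open>A\<close>; a nonexpansive \<open>A\<close> is enough, since the contraction of the new
    maps will come from the factor \<open>q\<close>.\<close>
  define A where "A x = S x - S 0" for x
  have "linear A"
    by (rule scaling_linear[of _ r]) (simp_all add: A_def r[unfolded dist_norm] dist_norm)
  moreover have "S x = A x + S 0" for x
    by (simp add: A_def)
  moreover have "norm (A x) \<le> norm x" for x
  proof -
    have "norm (A x) \<le> k * norm x"
      using k(2)[of x 0] by (simp add: A_def dist_norm)
    also have "\<dots> \<le> norm x"
      using k(1) by (simp add: mult_left_le_one_le mult_right_mono[of k 1, simplified])
    finally show ?thesis .
  qed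
  ultimately show ?thesis
    by (rule that)
qed

text \<open>The distance from \<open>T s\<close> to \<open>T 0\<close> is \<open>r * s\<close>;
  since \<open>T 0\<close> is an endpoint of the image, \<open>T s\<close> can lie on one side only,
  which fixes the sign. The unordered pair of endpoints admits both orientations, so one statement
  serves both values of the signature.\<close>

lemma similarity_map_interval_affine:
  fixes T :: "real \<Rightarrow> real"
  assumes sim: "similarity_map (submetric euclidean_metric {0..1}) T"
    and con: "contraction_map (submetric euclidean_metric {0..1}) T"
    and ends: "{T 0, T 1} = {a, b}" and image: "T ` {0..1} = {a..b}"
  shows "\<bar>T 1 - T 0\<bar> < 1" "\<And>s. s \<in> {0..1} \<Longrightarrow> T s = T 0 + (T 1 - T 0) * s"
proof -
  obtain r where r: "r > 0" "\<And>x y. x \<in> {0..1} \<Longrightarrow> y \<in> {0..1} \<Longrightarrow> \<bar>T x - T y\<bar> = r * \<bar>x - y\<bar>"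
    using sim by (auto simp: similarity_map_def dist_real_def)
  obtain k where k: "k < 1" "\<And>x y. x \<in> {0..1} \<Longrightarrow> y \<in> {0..1} \<Longrightarrow> \<bar>T x - T y\<bar> \<le> k * \<bar>x - y\<bar>"
    using con by (auto simp: contraction_map_def dist_real_def)
  show "\<bar>T 1 - T 0\<bar> < 1"
    using k(1) k(2)[of 1 0] by simp
  fix s :: real assume s: "s \<in> {0..1}"
  have r1: "\<bar>T 1 - T 0\<bar> = r" and rs: "\<bar>T s - T 0\<bar> = r * s"
    using r(2)[of 1 0] r(2)[of s 0] s by auto
  have "T s \<in> {a..b}"
    using s image by blast
  moreover have "(T 0 = a \<and> T 1 = b) \<or> (T 0 = b \<and> T 1 = a)"
    using ends by (auto simp: doubleton_eq_iff)
  ultimately have "(T 1 - T 0 = r \<and> T s - T 0 = r * s) \<or> (T 1 - T 0 = - r \<and> T s - T 0 = - (r * s))"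
    using r1 rs by auto
  then show "T s = T 0 + (T 1 - T 0) * s"
    by auto
qed

text \<open>Both sides agree at \<open>s = 0\<close> and have the same derivative, by the functional
  equation for \<open>f\<close>. Differentiating instead of substituting in the integral avoids a
  case distinction on the sign of \<open>q\<close>.\<close>

lemma integral_affine_reparametrization:
  fixes f g :: "real \<Rightarrow> 'a::euclidean_space"
  assumes cont: "continuous_on {0..1} f"
    and g: "\<And>s. s \<in> {0..1} \<Longrightarrow> g s = integral {0..s} f"
    and A: "linear A"
    and f: "\<And>s. s \<in> {0..1} \<Longrightarrow> f (a + q * s) = A (f s) + c"
    and range: "(\<lambda>s. a + q * s) ` {0..1} \<subseteq> {0..1}"
    and s: "s \<in> {0..1}"
  shows "g (a + q * s) = g a + q *\<^sub>R (A (g s) + s *\<^sub>R c)"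
proof -
  have g': "(g has_vector_derivative f x) (at x within {0..1})" if "x \<in> {0..1}" for x
    by (rule has_vector_derivative_transform[OF that g integral_has_vector_derivative[OF cont that]]) auto
  define h where "h x = g (a + q * x) - q *\<^sub>R (A (g x) + x *\<^sub>R c)" for x
  have h': "(h has_vector_derivative 0) (at x within {0..1})" if x: "x \<in> {0..1}" for x
  proof -
    have *: "((\<lambda>x. a + q * x) has_real_derivative q) (at x within {0..1})"
      by (auto intro!: derivative_eq_intros)
    \<comment> \<open>The chain rule needs the derivative of \<open>g\<close> only within the image
      of \<open>{0..1}\<close>, so one-sided derivatives at the endpoints suffice.\<close>
    have "(g has_vector_derivative f (a + q * x)) (at (a + q * x) within (\<lambda>s. a + q * s) ` {0..1})"
      using g'[of "a + q * x"] range x by (blast intro: has_vector_derivative_within_subset)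
    with * have 1: "((\<lambda>x. g (a + q * x)) has_vector_derivative q *\<^sub>R f (a + q * x)) (at x within {0..1})"
      using vector_diff_chain_within[of "\<lambda>x. a + q * x" q x "{0..1}" g "f (a + q * x)"]
      by (simp add: o_def has_real_derivative_iff_has_vector_derivative)
    have 2: "((\<lambda>x. A (g x)) has_vector_derivative A (f x)) (at x within {0..1})"
      using bounded_linear.has_vector_derivative[OF _ g'[OF x]] A
      by (simp add: linear_linear)
    have "(h has_vector_derivative q *\<^sub>R f (a + q * x) - q *\<^sub>R (A (f x) + c)) (at x within {0..1})"
      unfolding h_def
      by (auto intro!: derivative_eq_intros 1 2 simp: has_real_derivative_iff_has_vector_derivative[symmetric])
    then show ?thesis
      using f[OF x] by simp
  qed
  have "h s = h 0"
    using has_vector_derivative_zero_constant[of "{0..1}" h] h' s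
    by (metis atLeastAtMost_iff convex_real_interval(5) order_refl zero_le_one)
  moreover have "A (g 0) = 0"
    using g[of 0] linear_0[OF A] by simp
  ultimately show ?thesis
    by (simp add: h_def algebra_simps)
qed

section \<open>Covering by consecutive intervals and contraction of the affine maps\<close>

lemma UN_consecutive_intervals:
  fixes t :: "nat \<Rightarrow> real"
  assumes "\<And>i. i \<in> {1..m} \<Longrightarrow> t (i - 1) \<le> t i" "1 \<le> m"
  shows "(\<Union>i\<in>{1..m}. {t (i - 1)..t i}) = {t 0..t m}"
  using assms(2,1)
proof (induction m rule: dec_induct)
  case base
  then show ?case by simp
next
  case (step n)
  have "t 0 \<le> t k" if "k \<le> n" for k
    using that
  proof (induction k)
    case (Suc k)
    then show ?case using step.prems[of "Suc k"] by auto
  qed simp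
  then have "{t 0..t n} \<union> {t n..t (Suc n)} = {t 0..t (Suc n)}"
    using step.prems[of "Suc n"] by (intro ivl_disj_un_two_touch(4)) auto
  moreover have "(\<Union>i\<in>{1..Suc n}. {t (i - 1)..t i}) = (\<Union>i\<in>{1..n}. {t (i - 1)..t i}) \<union> {t n..t (Suc n)}"
    by (simp add: atLeastAtMostSuc_conv Un_commute)
  ultimately show ?case
    using step by simp
qed

text \<open>The shear \<open>s *\<^sub>R c\<close> is damped by the factor \<open>1 / C\<close> in the coordinates
  \<open>(C * s, x)\<close>.\<close>

lemma contraction_map_scaled_shear:
  fixes A :: "'a::euclidean_space \<Rightarrow> 'a" and C q :: real
  assumes A: "linear A" "\<And>x. norm (A x) \<le> norm x"
    and q: "\<bar>q\<bar> < 1" and C: "C > 0" "C > \<bar>q\<bar> * norm c / (1 - \<bar>q\<bar>)"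
  shows "contraction_map (euclidean_metric_in (\<lambda>(s, x). (C * s, x)))
    (\<lambda>(s, x). (a + q * s, b + q *\<^sub>R (A x + s *\<^sub>R c)))"
proof -
  let ?L = "\<lambda>(s :: real, x :: 'a). (C * s, x)"
  let ?R = "\<lambda>(s, x). (a + q * s, b + q *\<^sub>R (A x + s *\<^sub>R c))"
  have inj: "inj ?L"
    using C(1) by (auto simp: inj_def)
  \<comment> \<open>The first summand bounds the block-diagonal part and the second the damped
    shear; the lower bound on \<open>C\<close> says exactly that \<open>k < 1\<close>.\<close>
  define k where "k = \<bar>q\<bar> + \<bar>q\<bar> * norm c / C"
  have k0: "0 \<le> k"
    using C(1) by (simp add: k_def)
  have k1: "k < 1"
    using C q by (simp add: k_def field_simps)
  have "dist (?L (?R (s, x))) (?L (?R (s', x'))) \<le> k * dist (?L (s, x)) (?L (s', x'))" for s s' x x'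
  proof -
    define d e where "d = s - s'" and "e = x - x'"
    \<comment> \<open>Translations cancel. The first term has norm at most
      \<open>\<bar>q\<bar>\<close> times that of \<open>(C * d, e)\<close> because \<open>A\<close>
      is nonexpansive; the shear depends on \<open>d\<close> alone, and \<open>d\<close> is
      \<open>C * d\<close> divided by \<open>C\<close>.\<close>
    have "?L (?R (s, x)) - ?L (?R (s', x')) = q *\<^sub>R (C * d, A e) + (0, (q * d) *\<^sub>R c)"
      by (simp add: d_def e_def linear_diff[OF A(1)] algebra_simps)
    then have "dist (?L (?R (s, x))) (?L (?R (s', x')))
        \<le> norm (q *\<^sub>R (C * d, A e)) + norm (0 :: real, (q * d) *\<^sub>R c)"
      by (simp only: dist_norm norm_triangle_ineq)
    also have "\<dots> = \<bar>q\<bar> * norm (C * d, A e) + (\<bar>q\<bar> * norm c / C) * norm (C * d)"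
      using C(1) by (simp only: norm_scaleR norm_Pair2) (simp add: abs_mult)
    also have "\<dots> \<le> \<bar>q\<bar> * norm (C * d, e) + (\<bar>q\<bar> * norm c / C) * norm (C * d, e)"
    proof (intro add_mono mult_left_mono)
      show "norm (C * d, A e) \<le> norm (C * d, e)"
        using A(2) by (auto simp: norm_Pair intro!: power_mono)
      show "norm (C * d) \<le> norm (C * d, e)"
        by (simp add: norm_Pair real_le_rsqrt)
    qed (use C(1) in auto)
    also have "\<dots> = k * dist (?L (s, x)) (?L (s', x'))"
      by (simp add: k_def d_def e_def dist_norm algebra_simps)
    finally show ?thesis .
  qed
  then show ?thesis
    using k0 k1 unfolding contraction_map_def euclidean_metric_in_simps[OF inj]
    by (auto intro!: exI[of _ k])
qed

section \<open>The affine zipper in the product space and its attractor\<close>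

theorem proposition2:
  fixes m :: nat
    and S :: "nat \<Rightarrow> real ^ 'n \<Rightarrow> real ^ 'n"
    and z :: "nat \<Rightarrow> real ^ 'n"
    and \<epsilon> :: "nat \<Rightarrow> nat"
    and \<gamma> :: "(real ^ 'n) set"
    and T :: "nat \<Rightarrow> real \<Rightarrow> real"
    and t :: "nat \<Rightarrow> real"
    and f g :: "real \<Rightarrow> real ^ 'n"
  assumes "self_similar_zipper euclidean_metric m S z \<epsilon>"
    and "z 0 = 0"
    and "is_attractor euclidean_metric m S \<gamma>"
    and "line_zipper m T t \<epsilon>"
    and "linear_parametrization euclidean_metric m S z \<gamma> T t f"
    and "\<And>s. s \<in> {0..1} \<Longrightarrow> g s = integral {0..s} f"
  shows "\<exists>(L :: real \<times> (real ^ 'n) \<Rightarrow> real \<times> (real ^ 'n)) R Z.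
           linear L \<and> bij L \<and>
           self_affine_zipper (euclidean_metric_in L) m R Z \<epsilon> \<and>
           is_attractor (euclidean_metric_in L) m R {(s, g s) | s. s \<in> {0..1}}"
proof -
  have m: "1 \<le> m" and eps: "\<And>i. i \<in> {1..m} \<Longrightarrow> \<epsilon> i \<in> {0, 1}"
    using assms(1) by (auto simp: self_similar_zipper_def zipper_def)
  have t0: "t 0 = 0" and tm: "t m = 1"
    and t_less: "\<And>i. i \<in> {1..m} \<Longrightarrow> t (i - 1) < t i"
    and T_image: "\<And>i. i \<in> {1..m} \<Longrightarrow> T i ` {0..1} = {t (i - 1)..t i}"
    and T_sim: "\<And>i. i \<in> {1..m} \<Longrightarrow> similarity_map (submetric euclidean_metric {0..1}) (T i)"
    and T_con: "\<And>i. i \<in> {1..m} \<Longrightarrow> contraction_map (submetric euclidean_metric {0..1}) (T i)"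
    and t_range: "\<And>i. i \<in> {0..m} \<Longrightarrow> t i \<in> {0..1}"
    and T_ends: "\<And>i. i \<in> {1..m} \<Longrightarrow> T i (t 0) = t (i - 1 + \<epsilon> i) \<and> T i (t m) = t (i - \<epsilon> i)"
    using assms(4) by (auto simp: line_zipper_def self_similar_zipper_def zipper_def)
  have cont_f: "continuous_on {0..1} f"
    and f_T: "\<And>i s. i \<in> {1..m} \<Longrightarrow> s \<in> {0..1} \<Longrightarrow> f (T i s) = S i (f s)"
    using assms(5) by (auto simp: linear_parametrization_def)
  have "\<forall>i\<in>{1..m}. \<exists>A c. linear A \<and> (\<forall>x. S i x = A x + c) \<and> (\<forall>x. norm (A x) \<le> norm x)"
    using assms(1) similarity_map_euclidean_affine
    unfolding self_similar_zipper_def zipper_def by metis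
  then obtain A c where A: "\<And>i. i \<in> {1..m} \<Longrightarrow> linear (A i)"
    and S_eq: "\<And>i x. i \<in> {1..m} \<Longrightarrow> S i x = A i x + c i"
    and A_le: "\<And>i x. i \<in> {1..m} \<Longrightarrow> norm (A i x) \<le> norm x"
    by metis
  \<comment> \<open>The signed ratio of \<open>T i\<close>: negative exactly when
    \<open>\<epsilon> i = 1\<close>, where \<open>T i\<close> reverses orientation.\<close>
  define q where "q i = T i 1 - T i 0" for i
  have T_endset: "{T i 0, T i 1} = {t (i - 1), t i}" if "i \<in> {1..m}" for i
    using T_ends[OF that] eps[OF that] that by (auto simp: t0 tm)
  note T_affine = similarity_map_interval_affine[OF T_sim T_con T_endset T_image, folded q_def]
  have q: "\<bar>q i\<bar> < 1" if "i \<in> {1..m}" for i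
    using that by (intro T_affine(1))
  have T_eq: "T i s = T i 0 + q i * s" if "i \<in> {1..m}" "s \<in> {0..1}" for i s
    using that by (intro T_affine(2))
  have T_range: "T i s \<in> {0..1}" if "i \<in> {1..m}" "s \<in> {0..1}" for i s
    using T_con[OF that(1)] that(2) by (auto simp: contraction_map_def)
  \<comment> \<open>One stretching factor for all indices: the sum of nonnegative terms dominates
    each threshold, and the summand 1 makes the inequality strict and \<open>C\<close>
    positive.\<close>
  define C where "C = 1 + (\<Sum>i\<in>{1..m}. \<bar>q i\<bar> * norm (c i) / (1 - \<bar>q i\<bar>))"
  have C0: "C > 0"
    unfolding C_def using q by (intro add_pos_nonneg sum_nonneg) (auto intro!: divide_nonneg_pos)
  have C: "C > \<bar>q i\<bar> * norm (c i) / (1 - \<bar>q i\<bar>)" if "i \<in> {1..m}" for i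
  proof -
    have "\<bar>q i\<bar> * norm (c i) / (1 - \<bar>q i\<bar>) \<le> (\<Sum>i\<in>{1..m}. \<bar>q i\<bar> * norm (c i) / (1 - \<bar>q i\<bar>))"
      using that q by (intro member_le_sum) (auto intro!: divide_nonneg_pos)
    then show ?thesis
      by (simp add: C_def)
  qed
  define L where "L = (\<lambda>(s :: real, x :: real ^ 'n). (C * s, x))"
  \<comment> \<open>The time coordinate uses \<open>T i 0 + q i * s\<close> rather than
    \<open>T i s\<close>: \<open>R i\<close> must be affine on the whole space, while
    \<open>T i\<close> is controlled only on \<open>{0..1}\<close>.\<close>
  define R where "R i = (\<lambda>(s, x). (T i 0 + q i * s, g (T i 0) + q i *\<^sub>R (A i x + s *\<^sub>R c i)))" for i
  define G where "G s = (s, g s)" for s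
  have L: "linear L"
    by (rule linearI) (auto simp: L_def algebra_simps)
  have "bij L"
    by (rule o_bij[where g = "\<lambda>(s, x). (s / C, x)"]) (use C0 in \<open>auto simp: L_def fun_eq_iff\<close>)
  then have bij: "bij L" "inj L" "surj L"
    by (auto simp: bij_def)
  have R_con: "contraction_map (euclidean_metric_in L) (R i)" if "i \<in> {1..m}" for i
    unfolding L_def R_def
    by (rule contraction_map_scaled_shear[OF A[OF that] A_le[OF that] q[OF that] C0 C[OF that]])
  \<comment> \<open>The graph map \<open>G\<close> intertwines \<open>T i\<close> with
    \<open>R i\<close>, so vertex conditions and invariance carry over from the line zipper to the
    graph.\<close>
  have R_G: "R i (G s) = G (T i s)" if i: "i \<in> {1..m}" and s: "s \<in> {0..1}" for i s
  proof -
    have "g (T i 0 + q i * s) = g (T i 0) + q i *\<^sub>R (A i (g s) + s *\<^sub>R c i)"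
    proof (rule integral_affine_reparametrization[OF cont_f assms(6) A[OF i] _ _ s])
      show "f (T i 0 + q i * s) = A i (f s) + c i" if "s \<in> {0..1}" for s
        using f_T[OF i that] S_eq[OF i] T_eq[OF i that] by simp
      show "(\<lambda>s. T i 0 + q i * s) ` {0..1} \<subseteq> {0..1}"
        using T_range[OF i] T_eq[OF i] by (metis image_subsetI)
    qed
    then show ?thesis
      by (simp add: R_def G_def T_eq[OF i s])
  qed
  have affine: "affine_mapping (R i)" if "i \<in> {1..m}" for i
    unfolding affine_mapping_def
  proof (intro exI conjI)
    show "linear (\<lambda>(s, x). (q i * s, q i *\<^sub>R (A i x + s *\<^sub>R c i)))"
      by (rule linearI)
        (auto simp: linear_add[OF A[OF that]] linear_scale[OF A[OF that]] algebra_simps)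
    show "R i = (\<lambda>p. (case p of (s, x) \<Rightarrow> (q i * s, q i *\<^sub>R (A i x + s *\<^sub>R c i))) + (T i 0, g (T i 0)))"
      by (auto simp: R_def)
  qed
  \<comment> \<open>The vertices are the graph points above \<open>t i\<close>. As
    \<open>t 0 = 0\<close> and \<open>t m = 1\<close>, \<open>R_G\<close> at these two times reduces
    the vertex conditions to those of \<open>T\<close>, with the same signature.\<close>
  have "zipper (euclidean_metric_in L) m R (\<lambda>i. G (t i)) \<epsilon>"
    unfolding zipper_def
    using mcomplete_of_euclidean_metric_in[OF bij(2,3)] m eps R_con R_G T_ends t_range
    by (auto simp: euclidean_metric_in_simps[OF bij(2)] t0 tm)
  then have zip: "self_affine_zipper (euclidean_metric_in L) m R (\<lambda>i. G (t i)) \<epsilon>"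
    using affine by (simp add: self_affine_zipper_def)
  have "continuous_on {0..1} (\<lambda>s. integral {0..s} f)"
    using cont_f by (intro indefinite_integral_continuous_1 integrable_continuous_interval)
  then have "continuous_on {0..1} g"
    by (rule continuous_on_eq) (simp add: assms(6))
  then have "compact (G ` {0..1})"
    unfolding G_def by (intro compact_continuous_image continuous_intros) auto
  moreover have "G ` {0..1} = (\<Union>i\<in>{1..m}. R i ` G ` {0..1})"
  proof -
    \<comment> \<open>\<open>R i\<close> sends the graph to its part above
      \<open>{t (i - 1)..t i}\<close>, and these intervals cover \<open>{0..1}\<close>.\<close>
    have "(\<Union>i\<in>{1..m}. R i ` G ` {0..1}) = (\<Union>i\<in>{1..m}. G ` T i ` {0..1})"
      using R_G by (intro SUP_cong refl) (auto simp: image_image)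
    also have "\<dots> = G ` (\<Union>i\<in>{1..m}. {t (i - 1)..t i})"
      using T_image by auto
    also have "\<dots> = G ` {0..1}"
      using UN_consecutive_intervals[of m t] t_less m by (simp add: t0 tm less_imp_le)
    finally show ?thesis ..
  qed
  ultimately have "compact_invariant (euclidean_metric_in L) m R (G ` {0..1})"
    by (simp add: compact_invariant_def mtopology_of_euclidean_metric_in[OF L bij(1)])
  then have "is_attractor (euclidean_metric_in L) m R (G ` {0..1})"
    using compact_invariant_unique[OF L bij(1), where m = m and R = R] R_con
    unfolding is_attractor_def by blast
  moreover have "G ` {0..1} = {(s, g s) | s. s \<in> {0..1}}"
    by (auto simp: G_def)
  ultimately show ?thesis
    using L bij(1) zip by metis
qed

end
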